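(* Let $K$ be a space equipped with a measure $\mu$ and with the effective resistance metric $d$ associated to a Dirichlet form $\mathcal{E}$. Assume that there exist positive constants $b, C_0, C_1, C_2$ such that for all $x\in K$ and all $r>C_0$ $$C_1 r^b\leq \mu(B_r(x))\leq C_2 r^b .$$ Let $\gamma=b+1$. Then there exists a constant $C>0$ such that for all $u\in \mathcal{D}om(\mathcal{E})$ with $\|u\|_{2}=1$ one has $$\bigl(Var_\gamma(u)+1\bigr)\,\mathcal{E}(u,u)\geq C.$$
   Context: $(K,d)$ is a metric space equipped with a Borel measure $\mu$ (possibly with atoms), and $\mathcal{E}$ is a Dirichlet form with domain $\mathcal{D}om(\mathcal{E})\subset L^2(K,\mu)$. By convention, $\|u\|_2=\infty$ if $u$ is not square integrable and $\mathcal{E}(u,u)=\infty$ if $u\notin\mathcal{D}om(\mathcal{E})$. It is assumed that $d$ is the effective resistance metric associated to $\mathcal{E}$, i.e. that $$d(x,y)=\sup \mathcal{E}(u,u)^{-1},$$ where the supremum is over all continuous functions $u$ with $u(x)=1$, $u(y)=0$ (in particular this quantity is assumed to be finite); in this setting $\mathcal{E}$ is also called a resistance form (in the sense of Kigami, "Harmonic analysis for resistance forms"). $B_r(x)$ denotes the ball with center $x$ and radius $r$ in the metric $d$. The norm $\|\cdot\|_2$ is the norm of $L^2(K,\mu)$. The spatial variance is $$Var_\gamma(u)=\iint_{K\times K}d(x,y)^\gamma |u(x)|^2|u(y)|^2\,d\mu(x)\,d\mu(y).$$ The constant $C$ does not depend on $u$. *)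

theory Defs
  imports "HOL-Analysis.Analysis"
begin

text \<open>
  Elements of \<open>L\<^sup>2(M)\<close> are represented by functions; the axioms of a Dirichlet form below make
  its domain and its values invariant under almost everywhere equality.
\<close>

definition L2 :: "'a measure \<Rightarrow> ('a \<Rightarrow> real) set" where
  "L2 M = {u \<in> borel_measurable M. integrable M (\<lambda>x. (u x)\<^sup>2)}"

definition L2_norm :: "'a measure \<Rightarrow> ('a \<Rightarrow> real) \<Rightarrow> real" where
  "L2_norm M u = sqrt (\<integral>x. (u x)\<^sup>2 \<partial>M)"

text \<open>
  A Dirichlet form: a densely defined, closed, nonnegative, symmetric bilinear form on
  \<open>L\<^sup>2(M)\<close> with domain \<open>D\<close> on which the unit contraction operates.
  Closedness is completeness of \<open>D\<close> for the norm with square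
  \<open>E(u,u) + \<parallel>u\<parallel>\<^sup>2\<close>.
\<close>

locale dirichlet_form =
  fixes M :: "'a measure"
    and D :: "('a \<Rightarrow> real) set"
    and E :: "('a \<Rightarrow> real) \<Rightarrow> ('a \<Rightarrow> real) \<Rightarrow> real"
  assumes domain_L2: "D \<subseteq> L2 M"
    and domain_zero: "(\<lambda>x. 0) \<in> D"
    and domain_add: "\<lbrakk>u \<in> D; v \<in> D\<rbrakk> \<Longrightarrow> (\<lambda>x. u x + v x) \<in> D"
    and domain_scale: "u \<in> D \<Longrightarrow> (\<lambda>x. c * u x) \<in> D"
    and domain_AE: "\<lbrakk>u \<in> D; v \<in> borel_measurable M; AE x in M. u x = v x\<rbrakk> \<Longrightarrow> v \<in> D"
    and domain_dense: "\<lbrakk>u \<in> L2 M; e > 0\<rbrakk> \<Longrightarrow> \<exists>v\<in>D. L2_norm M (\<lambda>x. u x - v x) < e"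
    and form_AE: "\<lbrakk>u \<in> D; u' \<in> D; v \<in> D; AE x in M. u x = u' x\<rbrakk> \<Longrightarrow> E u v = E u' v"
    and form_add: "\<lbrakk>u \<in> D; v \<in> D; w \<in> D\<rbrakk> \<Longrightarrow> E (\<lambda>x. u x + v x) w = E u w + E v w"
    and form_scale: "\<lbrakk>u \<in> D; v \<in> D\<rbrakk> \<Longrightarrow> E (\<lambda>x. c * u x) v = c * E u v"
    and form_sym: "\<lbrakk>u \<in> D; v \<in> D\<rbrakk> \<Longrightarrow> E u v = E v u"
    and form_nonneg: "u \<in> D \<Longrightarrow> 0 \<le> E u u"
    and form_closed:
      "\<lbrakk>\<And>n. f n \<in> D;
        \<And>e. e > 0 \<Longrightarrow> \<exists>N. \<forall>m\<ge>N. \<forall>n\<ge>N.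
          E (\<lambda>x. f m x - f n x) (\<lambda>x. f m x - f n x) + (L2_norm M (\<lambda>x. f m x - f n x))\<^sup>2 < e\<rbrakk>
       \<Longrightarrow> \<exists>u\<in>D. (\<lambda>n. E (\<lambda>x. f n x - u x) (\<lambda>x. f n x - u x)
                      + (L2_norm M (\<lambda>x. f n x - u x))\<^sup>2) \<longlonglongrightarrow> 0"
    and form_markov:
      "u \<in> D \<Longrightarrow> (\<lambda>x. min (max (u x) 0) 1) \<in> D \<and>
        E (\<lambda>x. min (max (u x) 0) 1) (\<lambda>x. min (max (u x) 0) 1) \<le> E u u"

definition energy ::
  "('a \<Rightarrow> real) set \<Rightarrow> (('a \<Rightarrow> real) \<Rightarrow> ('a \<Rightarrow> real) \<Rightarrow> real) \<Rightarrow> ('a \<Rightarrow> real) \<Rightarrow> ennreal" where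
  "energy D E u = (if u \<in> D then ennreal (E u u) else \<infinity>)"

text \<open>
  In \<open>ennreal\<close>, \<open>inverse 0 = \<infinity>\<close> and \<open>inverse \<infinity> = 0\<close>, and the supremum over the empty set
  (the case \<open>x = y\<close>) is \<open>0\<close>.
\<close>

definition effective_resistance ::
  "('a::topological_space \<Rightarrow> real) set \<Rightarrow> (('a \<Rightarrow> real) \<Rightarrow> ('a \<Rightarrow> real) \<Rightarrow> real)
    \<Rightarrow> 'a \<Rightarrow> 'a \<Rightarrow> ennreal" where
  "effective_resistance D E x y =
    (SUP u \<in> {u. continuous_on UNIV u \<and> u x = 1 \<and> u y = 0}. inverse (energy D E u))"

text \<open>
  In a resistance form in the sense of Kigami the domain consists of genuine functions, continuous
  for the resistance metric; for a form on \<open>L\<^sup>2\<close> this says that every class in the domain has a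
  continuous representative. It is not a consequence of \<open>effective_resistance\<close> being a finite
  metric, since only continuous functions compete there: the form \<open>\<integral> \<bar>u'\<bar>\<^sup>2\<close> on the square
  integrable functions on the line that are \<open>H\<^sup>1\<close> off the integers, with arbitrary jumps at the
  integers, induces the Euclidean metric but vanishes on the indicator of \<open>[0,1]\<close>. (Kigami's
  axiom that constants belong to the domain cannot be imposed on a domain inside \<open>L\<^sup>2\<close> when the
  measure is infinite.)
\<close>

definition has_continuous_versions ::
  "'a::topological_space measure \<Rightarrow> ('a \<Rightarrow> real) set \<Rightarrow> bool" where
  "has_continuous_versions M D \<longleftrightarrow>
    (\<forall>u\<in>D. \<exists>v. continuous_on UNIV v \<and> (AE x in M. u x = v x))"

definition spatial_variance ::
  "'a::metric_space measure \<Rightarrow> real \<Rightarrow> ('a \<Rightarrow> real) \<Rightarrow> ennreal" where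
  "spatial_variance M \<gamma> u =
    (\<integral>\<^sup>+ y. (\<integral>\<^sup>+ x. ennreal (dist x y powr \<gamma> * \<bar>u x\<bar>\<^sup>2 * \<bar>u y\<bar>\<^sup>2) \<partial>M) \<partial>M)"

end

theory Submission
  imports Defs
begin

text \<open>
  The Markov property lets one cut a continuous \<open>u \<in> D\<close> down to its part between two nonnegative
  levels without increasing the energy, so although constants are not in \<open>D\<close> the resistance metric
  still controls oscillations: \<open>\<bar>u x\<bar> \<le> \<bar>u y\<bar> + sqrt (d(x,y) E(u,u))\<close>.
  With \<open>R\<^sup>\<gamma>\<close> comparable to \<open>Var\<^sub>\<gamma>(u) + 1\<close>, Chebyshev's inequality puts half of the mass of \<open>u\<^sup>2\<close> in some
  ball of radius \<open>R\<close>, so \<open>u\<^sup>2\<close> is at least of order \<open>R\<^sup>-\<^sup>b\<close> at some point. If \<open>E(u,u)\<close> were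
  much smaller than \<open>R\<^sup>-\<^sup>b\<^sup>-\<^sup>1\<close>, this lower bound would persist on a ball of radius \<open>\<lambda> R\<close> with
  \<open>\<lambda>\<close> large, whose volume of order \<open>(\<lambda> R)\<^sup>b\<close> would force \<open>\<parallel>u\<parallel>\<^sub>2 > 1\<close>.
\<close>

section \<open>Energy of truncations\<close>

context dirichlet_form
begin

lemma form_quadratic:
  assumes "u \<in> D" "v \<in> D"
  shows "E (\<lambda>x. u x + t * v x) (\<lambda>x. u x + t * v x) = E u u + 2 * t * E u v + t\<^sup>2 * E v v"
proof -
  let ?s = "\<lambda>x. u x + t * v x"
  have tv: "(\<lambda>x. t * v x) \<in> D" using assms domain_scale by blast
  have s: "?s \<in> D" using domain_add[OF assms(1) tv] .
  have expand: "E ?s w = E u w + t * E v w" if "w \<in> D" for w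
    using form_add[OF assms(1) tv that] form_scale[OF assms(2) that] by simp
  have "E ?s ?s = E ?s u + t * E ?s v"
    using expand[OF s] form_sym[OF assms(1) s] form_sym[OF assms(2) s] by simp
  then show ?thesis
    using expand[OF assms(1)] expand[OF assms(2)] form_sym[OF assms]
    by (simp add: algebra_simps power2_eq_square)
qed

lemma form_scale2:
  assumes "u \<in> D"
  shows "E (\<lambda>x. c * u x) (\<lambda>x. c * u x) = c\<^sup>2 * E u u"
proof -
  have cu: "(\<lambda>x. c * u x) \<in> D" using assms domain_scale by blast
  show ?thesis
    using form_scale[OF assms cu] form_sym[OF assms cu] form_scale[OF assms assms]
    by (simp add: power2_eq_square)
qed

text \<open>The unit contraction applied to \<open>u / c\<close> and scaled back by
  \<open>c\<close>. The level 0, where this rescaling degenerates, leaves the zero function.\<close>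

lemma form_truncation:
  assumes "u \<in> D" "c \<ge> 0"
  shows "(\<lambda>x. min (max (u x) 0) c) \<in> D"
    and "E (\<lambda>x. min (max (u x) 0) c) (\<lambda>x. min (max (u x) 0) c) \<le> E u u"
proof -
  let ?f = "\<lambda>x. min (max (u x) 0) c"
  have "?f \<in> D \<and> E ?f ?f \<le> E u u"
  proof (cases "c = 0")
    case True
    then have "?f = (\<lambda>x. 0 * u x)" by auto
    then show ?thesis
      using domain_scale[OF assms(1), of 0] form_scale2[OF assms(1), of 0] form_nonneg[OF assms(1)]
      by simp
  next
    case False
    with assms have c: "c > 0" by simp
    let ?v = "\<lambda>x. (1 / c) * u x"
    let ?g = "\<lambda>x. min (max (?v x) 0) 1"
    have v: "?v \<in> D" using assms(1) by (rule domain_scale)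
    have g: "?g \<in> D" "E ?g ?g \<le> E ?v ?v" using form_markov[OF v] by auto
    have f: "?f = (\<lambda>x. c * ?g x)"
      using c by (auto simp: min_def max_def field_simps)
    have "E ?f ?f = c\<^sup>2 * E ?g ?g" unfolding f using g(1) by (rule form_scale2)
    also have "\<dots> \<le> c\<^sup>2 * E ?v ?v" using g(2) by (intro mult_left_mono) auto
    also have "\<dots> = E u u" using form_scale2[OF assms(1), of "1 / c"] c by (simp add: power_divide)
    finally show ?thesis unfolding f using domain_scale[OF g(1)] by simp
  qed
  then show "?f \<in> D" "E ?f ?f \<le> E u u" by auto
qed

text \<open>With \<open>f\<close> the truncation and \<open>w = u - f\<close>, truncating
  \<open>f + t * w\<close> gives \<open>f\<close> again for every t > 0. Hence moving from
  \<open>f\<close> in the direction \<open>w\<close> cannot lower the energy, which forces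
  \<open>E f w\<close> to be nonnegative. Expanding the energy of \<open>f + w\<close> then bounds
  that of \<open>w\<close>.\<close>

lemma form_excess:
  assumes "u \<in> D" "c \<ge> 0"
  shows "(\<lambda>x. u x - min (max (u x) 0) c) \<in> D"
    and "E (\<lambda>x. u x - min (max (u x) 0) c) (\<lambda>x. u x - min (max (u x) 0) c) \<le> E u u"
proof -
  let ?f = "\<lambda>x. min (max (u x) 0) c"
  let ?w = "\<lambda>x. u x - ?f x"
  have f: "?f \<in> D" using assms by (rule form_truncation)
  have w: "?w \<in> D"
    using domain_add[OF assms(1) domain_scale[OF f, of "-1"]] by simp
  have le: "0 \<le> 2 * E ?f ?w + t * E ?w ?w" if t: "t > 0" for t
  proof -
    let ?s = "\<lambda>x. ?f x + t * ?w x"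
    have s: "?s \<in> D" using domain_add[OF f domain_scale[OF w]] .
    have "min (max (?s x) 0) c = ?f x" for x
    proof (cases "u x > c")
      case True
      then have "t * (u x - c) \<ge> 0" using t by simp
      with True assms(2) show ?thesis by (auto simp: min_def max_def)
    next
      case False
      then show ?thesis
        using t assms(2) by (auto simp: min_def max_def mult_le_0_iff zero_le_mult_iff)
    qed
    then have "E ?f ?f \<le> E ?s ?s" using form_truncation(2)[OF s assms(2)] by simp
    also have "\<dots> = E ?f ?f + t * (2 * E ?f ?w + t * E ?w ?w)"
      using form_quadratic[OF f w, of t] by (simp add: algebra_simps power2_eq_square)
    finally show ?thesis using t by (simp add: zero_le_mult_iff)
  qed
  have "0 \<le> E ?f ?w"
  proof (rule ccontr)
    assume neg: "\<not> 0 \<le> E ?f ?w"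
    define W where "W = E ?w ?w"
    have W: "W \<ge> 0" using form_nonneg[OF w] by (simp add: W_def)
    \<comment> \<open>A small positive \<open>t\<close> contradicts \<open>le\<close>. Dividing by
      \<open>W + 1\<close> instead of \<open>W\<close> covers the case \<open>W = 0\<close>.\<close>
    have "- E ?f ?w / (W + 1) > 0" using neg W by (intro divide_pos_pos) auto
    from le[OF this] have "0 \<le> 2 * E ?f ?w + (- E ?f ?w / (W + 1)) * W"
      by (simp only: W_def)
    also have "\<dots> = E ?f ?w * ((W + 2) / (W + 1))" using W by (simp add: field_simps)
    finally have "0 \<le> E ?f ?w * ((W + 2) / (W + 1))" .
    moreover have "(W + 2) / (W + 1) > 0" using W by (intro divide_pos_pos) auto
    ultimately show False using neg by (simp only: zero_le_mult_iff) linarith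
  qed
  then have "E ?w ?w \<le> E u u"
    using form_quadratic[OF f w, of 1] form_truncation(1)[OF assms] form_nonneg[OF f] by simp
  then show "?w \<in> D" "E ?w ?w \<le> E u u" using w by auto
qed

end

section \<open>Oscillation bounds from the resistance metric\<close>

text \<open>Normalised to the value 1 at \<open>x\<close>, the function \<open>w\<close> competes in
  the supremum that defines the effective resistance.\<close>

lemma resistance_bound:
  fixes M :: "'a::topological_space measure"
  assumes "dirichlet_form M D E"
    and r: "ennreal r = effective_resistance D E x y" "r \<ge> 0"
    and w: "w \<in> D" "continuous_on UNIV w" "w y = 0"
  shows "(w x)\<^sup>2 \<le> r * E w w"
proof (cases "w x = 0")
  case True
  then show ?thesis using dirichlet_form.form_nonneg[OF assms(1) w(1)] r by simp
next
  case False
  interpret dirichlet_form M D E by fact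
  let ?v = "\<lambda>z. (1 / w x) * w z"
  have v: "?v \<in> D" using w(1) by (rule domain_scale)
  have Ev: "E ?v ?v = E w w / (w x)\<^sup>2"
    using form_scale2[OF w(1), of "1 / w x"] by (simp add: power_divide)
  have "inverse (energy D E ?v) \<le> effective_resistance D E x y"
    unfolding effective_resistance_def
    using False w by (intro SUP_upper) (auto intro!: continuous_intros)
  then have le: "inverse (ennreal (E ?v ?v)) \<le> ennreal r"
    using v r by (simp add: energy_def)
  \<comment> \<open>Zero energy would make the inverse infinite, whereas the resistance is the
    finite number \<open>r\<close>.\<close>
  have pos: "E ?v ?v > 0"
  proof (rule ccontr)
    assume "\<not> E ?v ?v > 0"
    then have "ennreal (E ?v ?v) = 0" by (simp add: ennreal_neg)
    with le show False by (simp add: top_unique)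
  qed
  then have "inverse (E ?v ?v) \<le> r"
    using le r(2) by (simp only: inverse_ennreal ennreal_le_iff)
  then have "1 \<le> r * E ?v ?v" using pos by (simp add: field_simps)
  then show ?thesis unfolding Ev using False by (simp add: field_simps)
qed

lemma abs_le_resistance:
  fixes M :: "'a::topological_space measure"
  assumes "dirichlet_form M D E"
    and r: "ennreal r = effective_resistance D E x y" "r \<ge> 0"
    and v: "v \<in> D" "continuous_on UNIV v"
  shows "\<bar>v x\<bar> \<le> \<bar>v y\<bar> + sqrt (r * E v v)"
proof -
  interpret dirichlet_form M D E by fact
  have upper: "u x \<le> \<bar>u y\<bar> + sqrt (r * E u u)"
    if u: "u \<in> D" "continuous_on UNIV u" for u
  proof -
    define a where "a = max (u y) 0"
    \<comment> \<open>The excess \<open>?w\<close> keeps the negative part of \<open>u\<close>, so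
      it may be negative at \<open>y\<close>. The second truncation makes the value at
      \<open>y\<close> zero and preserves \<open>u x - a\<close> at \<open>x\<close> if that is
      nonnegative.\<close>
    let ?w = "\<lambda>z. u z - min (max (u z) 0) a"
    let ?g = "\<lambda>z. min (max (?w z) 0) (max (u x - a) 0)"
    have a: "a \<ge> 0" by (simp add: a_def)
    have w: "?w \<in> D" "E ?w ?w \<le> E u u" using form_excess[OF u(1) a] by auto
    have g: "?g \<in> D" "E ?g ?g \<le> E ?w ?w"
      using form_truncation[OF w(1), of "max (u x - a) 0"] by auto
    have "(?g x)\<^sup>2 \<le> r * E ?g ?g"
    proof (rule resistance_bound[OF assms(1) r g(1)])
      show "continuous_on UNIV ?g" by (intro continuous_intros u)
      show "?g y = 0" by (auto simp: a_def min_def max_def)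
    qed
    also have "\<dots> \<le> r * E u u" using g(2) w(2) r(2) by (intro mult_left_mono) auto
    finally have "?g x \<le> sqrt (r * E u u)" by (rule real_le_rsqrt)
    moreover have "u x - a \<le> ?g x" using a by (auto simp: min_def max_def)
    moreover have "a \<le> \<bar>u y\<bar>" by (auto simp: a_def)
    ultimately show ?thesis by linarith
  qed
  have "(\<lambda>z. (-1) * v z) \<in> D" using v(1) by (rule domain_scale)
  moreover have "continuous_on UNIV (\<lambda>z. (-1) * v z)" by (intro continuous_intros v)
  ultimately have "- v x \<le> \<bar>v y\<bar> + sqrt (r * E v v)"
    using upper[of "\<lambda>z. (-1) * v z"] form_scale2[OF v(1), of "-1"] by simp
  with upper[OF v] show ?thesis by linarith
qed

lemma borel_measurable_continuous:
  assumes "sets M = sets borel" "continuous_on UNIV f"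
  shows "f \<in> borel_measurable M"
  unfolding measurable_cong_sets[OF assms(1) refl]
  using assms(2) by (rule borel_measurable_continuous_onI)

section \<open>Mass on balls and concentration\<close>

text \<open>Within distance \<open>s\<close> of \<open>x\<close> the oscillation term is at most
  half of \<open>\<bar>v x\<bar>\<close>, so at least half of that value persists on the whole
  ball.\<close>

lemma nn_integral_square_lower_bound:
  fixes M :: "'a::metric_space measure"
  assumes sets: "sets M = sets borel"
    and osc: "\<And>y. \<bar>v x\<bar> \<le> \<bar>v y\<bar> + sqrt (dist x y * e)"
    and e: "e \<ge> 0" "4 * s * e < (v x)\<^sup>2"
  shows "ennreal ((v x)\<^sup>2 / 4) * emeasure M (ball x s) \<le> (\<integral>\<^sup>+ y. ennreal ((v y)\<^sup>2) \<partial>M)"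
proof -
  have "ennreal ((v x)\<^sup>2 / 4) * emeasure M (ball x s)
      = (\<integral>\<^sup>+ y. ennreal ((v x)\<^sup>2 / 4) * indicator (ball x s) y \<partial>M)"
    using sets by (subst nn_integral_cmult_indicator) auto
  also have "\<dots> \<le> (\<integral>\<^sup>+ y. ennreal ((v y)\<^sup>2) \<partial>M)"
  proof (rule nn_integral_mono)
    fix y
    have "(v x)\<^sup>2 / 4 \<le> (v y)\<^sup>2" if y: "dist x y < s"
    proof -
      have "dist x y * e \<le> s * e" using y e by (intro mult_right_mono) auto
      also have "\<dots> \<le> (\<bar>v x\<bar> / 2)\<^sup>2" using e(2) by (simp add: power_divide)
      finally have "sqrt (dist x y * e) \<le> \<bar>v x\<bar> / 2"
        by (intro real_le_lsqrt) auto
      then have "\<bar>v x\<bar> / 2 \<le> \<bar>v y\<bar>" using osc[of y] by linarith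
      then have "(\<bar>v x\<bar> / 2)\<^sup>2 \<le> \<bar>v y\<bar>\<^sup>2" by (intro power_mono) auto
      then show ?thesis by (simp add: power_divide)
    qed
    then show "ennreal ((v x)\<^sup>2 / 4) * indicator (ball x s) y \<le> ennreal ((v y)\<^sup>2)"
      by (auto simp: indicator_def intro!: ennreal_leI)
  qed
  finally show ?thesis .
qed

text \<open>The spatial variance is the average of the moments about \<open>y\<close> with respect
  to the probability measure of density u^2, so not all of these moments can reach
  \<open>K\<close>.\<close>

lemma spatial_variance_center:
  assumes sets: "sets M = sets borel"
    and u: "u \<in> borel_measurable M" "(\<integral>\<^sup>+ x. ennreal ((u x)\<^sup>2) \<partial>M) = 1"
    and K: "spatial_variance M \<gamma> u < K"
  shows "\<exists>y. (\<integral>\<^sup>+ x. ennreal (dist x y powr \<gamma> * (u x)\<^sup>2) \<partial>M) < K"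
proof (rule ccontr)
  assume "\<not> ?thesis"
  then have ge: "K \<le> (\<integral>\<^sup>+ x. ennreal (dist x y powr \<gamma> * (u x)\<^sup>2) \<partial>M)" for y
    by (simp add: not_less)
  have [measurable]: "(\<lambda>x. dist x y) \<in> borel_measurable M" for y
    by (intro borel_measurable_continuous[OF sets] continuous_intros)
  note u(1)[measurable]
  have "K = (\<integral>\<^sup>+ y. K * ennreal ((u y)\<^sup>2) \<partial>M)"
    using u(2) by (subst nn_integral_cmult) auto
  also have "\<dots> \<le> (\<integral>\<^sup>+ y. (\<integral>\<^sup>+ x. ennreal (dist x y powr \<gamma> * (u x)\<^sup>2) \<partial>M) * ennreal ((u y)\<^sup>2) \<partial>M)"
    by (intro nn_integral_mono mult_right_mono ge) auto
  also have "\<dots> = (\<integral>\<^sup>+ y. (\<integral>\<^sup>+ x. ennreal (dist x y powr \<gamma> * (u x)\<^sup>2) * ennreal ((u y)\<^sup>2) \<partial>M) \<partial>M)"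
    by (intro nn_integral_cong nn_integral_multc[symmetric]) auto
  also have "\<dots> = spatial_variance M \<gamma> u"
    unfolding spatial_variance_def by (intro nn_integral_cong) (auto simp: ennreal_mult')
  finally show False using K by simp
qed

text \<open>If v^2 were at most \<open>1 / (2 * m)\<close> everywhere, the ball would carry at most
  half of the mass, and by Chebyshev its complement strictly less than half.\<close>

lemma large_value_in_ball:
  fixes M :: "'a::metric_space measure" and u :: "'a \<Rightarrow> real"
  assumes sets: "sets M = sets borel"
    and u: "u \<in> borel_measurable M" "(\<integral>\<^sup>+ x. ennreal ((u x)\<^sup>2) \<partial>M) = 1"
    and moment: "(\<integral>\<^sup>+ x. ennreal (dist x y powr \<gamma> * (u x)\<^sup>2) \<partial>M) < ennreal (R powr \<gamma> / 2)"
    and R: "R > 0" "\<gamma> > 0"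
    and vol: "emeasure M (ball y R) \<le> ennreal m" "m > 0"
    and v: "AE x in M. u x = v x"
  shows "\<exists>x. (v x)\<^sup>2 > 1 / (2 * m)"
proof (rule ccontr)
  assume "\<not> ?thesis"
  then have small: "(v x)\<^sup>2 \<le> 1 / (2 * m)" for x by (simp add: not_less)
  let ?G = "\<integral>\<^sup>+ x. ennreal (dist x y powr \<gamma> * (u x)\<^sup>2) \<partial>M"
  let ?c = "1 / R powr \<gamma>"
  have c: "?c > 0" using R by simp
  have [measurable]: "(\<lambda>x. dist x y) \<in> borel_measurable M"
    by (intro borel_measurable_continuous[OF sets] continuous_intros)
  have [measurable]: "ball y R \<in> sets M" using sets by auto
  note u(1)[measurable]
  have "1 \<le> (\<integral>\<^sup>+ x. ennreal (1 / (2 * m)) * indicator (ball y R) x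
                 + ennreal ?c * ennreal (dist x y powr \<gamma> * (u x)\<^sup>2) \<partial>M)"
    unfolding u(2)[symmetric]
  proof (rule nn_integral_mono_AE, use v in eventually_elim)
    fix x assume x: "u x = v x"
    show "ennreal ((u x)\<^sup>2) \<le> ennreal (1 / (2 * m)) * indicator (ball y R) x
                 + ennreal ?c * ennreal (dist x y powr \<gamma> * (u x)\<^sup>2)"
    proof (cases "x \<in> ball y R")
      case True
      then have "ennreal ((u x)\<^sup>2) \<le> ennreal (1 / (2 * m)) * indicator (ball y R) x"
        using small[of x] x by (auto intro!: ennreal_leI)
      then show ?thesis by (rule order_trans) simp
    next
      case False
      then have "R powr \<gamma> \<le> dist x y powr \<gamma>"
        using R by (intro powr_mono2) (auto simp: dist_commute)
      then have "1 \<le> ?c * dist x y powr \<gamma>" using R by (simp add: field_simps)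
      then have "1 * (u x)\<^sup>2 \<le> (?c * dist x y powr \<gamma>) * (u x)\<^sup>2" by (intro mult_right_mono) auto
      then have "ennreal ((u x)\<^sup>2) \<le> ennreal ?c * ennreal (dist x y powr \<gamma> * (u x)\<^sup>2)"
        using c by (subst ennreal_mult[symmetric]) (auto intro!: ennreal_leI simp: mult.assoc)
      then show ?thesis by (rule order_trans) simp
    qed
  qed
  also have "\<dots> = ennreal (1 / (2 * m)) * emeasure M (ball y R) + ennreal ?c * ?G"
    by (subst nn_integral_add) (auto simp: nn_integral_cmult nn_integral_cmult_indicator)
  also have "\<dots> \<le> ennreal (1 / (2 * m)) * ennreal m + ennreal ?c * ?G"
    by (intro add_right_mono mult_left_mono vol) auto
  also have "\<dots> = ennreal (1 / 2) + ennreal ?c * ?G"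
    using vol(2) by (simp add: ennreal_mult[symmetric])
  also have "\<dots> < ennreal (1 / 2) + ennreal (1 / 2)"
  proof -
    have "ennreal ?c * ?G < ennreal ?c * ennreal (R powr \<gamma> / 2)"
      using moment c by (intro ennreal_mult_strict_left_mono) auto
    also have "\<dots> = ennreal (1 / 2)" using R by (subst ennreal_mult[symmetric]) auto
    finally show ?thesis by (simp add: ennreal_add_left_cancel_less)
  qed
  also have "\<dots> = 1" by (subst ennreal_plus[symmetric]) auto
  finally show False by simp
qed

section \<open>The uncertainty inequality\<close>

theorem theorem3:
  fixes \<mu> :: "'a::metric_space measure"
    and D :: "('a \<Rightarrow> real) set"
    and E :: "('a \<Rightarrow> real) \<Rightarrow> ('a \<Rightarrow> real) \<Rightarrow> real"
    and b C0 C1 C2 \<gamma> :: real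
  assumes borel_measure: "sets \<mu> = sets borel"
    and dirichlet: "dirichlet_form \<mu> D E"
    and resistance_metric: "\<And>x y. ennreal (dist x y) = effective_resistance D E x y"
    and resistance_form: "has_continuous_versions \<mu> D"
    and positive: "b > 0" "C0 > 0" "C1 > 0" "C2 > 0"
    and volume_growth: "\<And>x r. r > C0 \<Longrightarrow>
          ennreal (C1 * r powr b) \<le> emeasure \<mu> (ball x r) \<and>
          emeasure \<mu> (ball x r) \<le> ennreal (C2 * r powr b)"
    and gamma: "\<gamma> = b + 1"
  shows "\<exists>C>0. \<forall>u\<in>D. L2_norm \<mu> u = 1 \<longrightarrow>
           (spatial_variance \<mu> \<gamma> u + 1) * energy D E u \<ge> ennreal C"
proof -
  interpret dirichlet_form \<mu> D E by fact
  \<comment> \<open>The dilation factor \<open>l\<close> satisfies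
    \<open>l powr b \<ge> 8 * C2 / C1\<close>, enough for the enlarged ball to hold too much mass;
    the summand 1 keeps \<open>l * R\<close> above \<open>C0\<close>. The constant \<open>A\<close>
    absorbs \<open>C0\<close> when \<open>K\<close> is bounded by a multiple of
    \<open>V + 1\<close>.\<close>
  define l where "l = 1 + (8 * C2 / C1) powr (1 / b)"
  define A where "A = 1 + C0 powr \<gamma>"
  define C where "C = 1 / (16 * C2 * l * A)"
  have l: "l \<ge> 1" by (simp add: l_def)
  have A: "A \<ge> 1" by (simp add: A_def)
  have C: "C > 0" using l A positive by (simp add: C_def)
  have lb: "8 * C2 / C1 \<le> l powr b"
  proof -
    have "8 * C2 / C1 = ((8 * C2 / C1) powr (1 / b)) powr b"
      using positive by (simp add: powr_powr)
    also have "\<dots> \<le> l powr b" using positive by (intro powr_mono2) (auto simp: l_def)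
    finally show ?thesis .
  qed
  have "ennreal C \<le> (spatial_variance \<mu> \<gamma> u + 1) * energy D E u"
    if u: "u \<in> D" and norm: "L2_norm \<mu> u = 1" for u
  proof -
    have uL2: "u \<in> borel_measurable \<mu>" "integrable \<mu> (\<lambda>x. (u x)\<^sup>2)"
      using u domain_L2 by (auto simp: L2_def)
    have one: "(\<integral>\<^sup>+ x. ennreal ((u x)\<^sup>2) \<partial>\<mu>) = 1"
      using norm uL2(2) by (simp add: nn_integral_eq_integral L2_norm_def)
    \<comment> \<open>Only continuous functions compete for the resistance; the continuous version
      \<open>v\<close> has the same energy and norm as \<open>u\<close>.\<close>
    obtain v where v: "continuous_on UNIV v" "AE x in \<mu>. u x = v x"
      using resistance_form u by (auto simp: has_continuous_versions_def)
    have vm: "v \<in> borel_measurable \<mu>"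
      using borel_measurable_continuous[OF borel_measure v(1)] .
    have vD: "v \<in> D" using domain_AE[OF u vm v(2)] .
    define e where "e = E u u"
    have Ev: "E v v = e"
      using form_AE[OF u vD u v(2)] form_AE[OF u vD vD v(2)] form_sym[OF u vD] by (simp add: e_def)
    have e0: "e \<ge> 0" using form_nonneg[OF u] by (simp add: e_def)
    have onev: "(\<integral>\<^sup>+ x. ennreal ((v x)\<^sup>2) \<partial>\<mu>) = 1"
      unfolding one[symmetric]
      by (rule nn_integral_cong_AE) (use v(2) in \<open>auto elim!: eventually_mono\<close>)
    have osc: "\<bar>v x\<bar> \<le> \<bar>v y\<bar> + sqrt (dist x y * e)" for x y
      using abs_le_resistance[OF dirichlet resistance_metric _ vD v(1), of x y] Ev by simp
    \<comment> \<open>Otherwise v^2 is at least a quarter of its value at \<open>x\<close> on the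
      ball of radius \<open>s\<close>, which gives total mass above 1.\<close>
    have energy_lower: "(v x)\<^sup>2 \<le> 4 * s * e"
      if s: "s > C0" "(v x)\<^sup>2 * (C1 * s powr b) > 4" for x s
    proof (rule ccontr)
      assume "\<not> ?thesis"
      then have "ennreal ((v x)\<^sup>2 / 4) * emeasure \<mu> (ball x s) \<le> 1"
        using nn_integral_square_lower_bound[OF borel_measure osc e0, of s x] onev by simp
      moreover have "ennreal ((v x)\<^sup>2 / 4) * ennreal (C1 * s powr b)
          \<le> ennreal ((v x)\<^sup>2 / 4) * emeasure \<mu> (ball x s)"
        using volume_growth[OF s(1)] by (intro mult_left_mono) auto
      ultimately have "ennreal ((v x)\<^sup>2 / 4 * (C1 * s powr b)) \<le> 1"
        using positive by (subst ennreal_mult) auto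
      then have "(v x)\<^sup>2 / 4 * (C1 * s powr b) \<le> 1" by simp
      then show False using s by simp
    qed
    have energy: "energy D E u = ennreal e" using u by (simp add: energy_def e_def)
    show ?thesis
    proof (cases "spatial_variance \<mu> \<gamma> u")
      case top
      \<comment> \<open>Since \<open>\<infinity> * 0 = 0\<close> in \<open>ennreal\<close>, a positive energy is needed here.\<close>
      have "e > 0"
      proof -
        obtain x where x: "v x \<noteq> 0"
        proof (rule ccontr)
          assume "\<not> thesis"
          then have "v = (\<lambda>x. 0)" using that by blast
          with onev show False by simp
        qed
        \<comment> \<open>The numerator 5 is any number above 4: once
          \<open>s powr b \<ge> k\<close>, the mass condition of \<open>energy_lower\<close> holds
          strictly.\<close>
        define k where "k = 5 / ((v x)\<^sup>2 * C1)"
        define s where "s = C0 + 1 + k powr (1 / b)"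
        have k: "k > 0" using x positive by (simp add: k_def)
        have s: "s > C0" by (simp add: s_def add_pos_nonneg)
        have "k = (k powr (1 / b)) powr b" using k positive by (simp add: powr_powr)
        also have "\<dots> \<le> s powr b" using positive by (intro powr_mono2) (auto simp: s_def)
        finally have "(v x)\<^sup>2 * (C1 * k) \<le> (v x)\<^sup>2 * (C1 * s powr b)"
          using positive by (intro mult_left_mono) auto
        then have "(v x)\<^sup>2 * (C1 * s powr b) > 4" using x positive by (simp add: k_def)
        with s have "(v x)\<^sup>2 \<le> 4 * s * e" by (rule energy_lower)
        then have "e \<noteq> 0" using x by auto
        with e0 show ?thesis by simp
      qed
      then show ?thesis by (simp add: top energy ennreal_top_mult)
    next
      case (real V)
      \<comment> \<open>The summand 1 puts \<open>K\<close> strictly above the variance, and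
        \<open>C0 powr \<gamma>\<close> ensures \<open>R > C0\<close>, so that volume growth
        applies. The radius is chosen to make \<open>K\<close> equal to
        \<open>R powr \<gamma> / 2\<close>, the moment bound in
        \<open>large_value_in_ball\<close>.\<close>
      define K where "K = V + 1 + C0 powr \<gamma>"
      define R where "R = (2 * K) powr (1 / \<gamma>)"
      have \<gamma>: "\<gamma> > 0" using gamma positive by simp
      have K: "K > 0" using real by (simp add: K_def add_pos_nonneg)
      have R\<gamma>: "R powr \<gamma> = 2 * K" using \<gamma> K by (simp add: R_def powr_powr)
      have "C0 = (C0 powr \<gamma>) powr (1 / \<gamma>)" using \<gamma> positive by (simp add: powr_powr)
      also have "\<dots> < R" unfolding R_def
      proof (rule powr_less_mono2)
        show "C0 powr \<gamma> < 2 * K"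
          using real(1) powr_ge_zero[of C0 \<gamma>] unfolding K_def distrib_left by linarith
      qed (use \<gamma> in auto)
      finally have R: "R > C0" .
      then have R0: "R > 0" using positive by simp
      have "spatial_variance \<mu> \<gamma> u < ennreal K"
        using real by (auto simp: K_def intro!: ennreal_lessI add_pos_nonneg)
      then obtain y where "(\<integral>\<^sup>+ x. ennreal (dist x y powr \<gamma> * (u x)\<^sup>2) \<partial>\<mu>) < ennreal K"
        using spatial_variance_center[OF borel_measure uL2(1) one] by blast
      then obtain x where x: "(v x)\<^sup>2 > 1 / (2 * (C2 * R powr b))"
        using large_value_in_ball[OF borel_measure uL2(1) one, of y \<gamma> R "C2 * R powr b" v]
          volume_growth[OF R] R\<gamma> R0 \<gamma> v(2) positive by auto
      have "1 * R \<le> l * R" using l R0 by (intro mult_right_mono) auto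
      then have "l * R > C0" using R by linarith
      moreover have "(v x)\<^sup>2 * (C1 * (l * R) powr b) > 4"
      proof -
        \<comment> \<open>The powers of \<open>R\<close> cancel, so a dilation factor independent of
          \<open>u\<close> suffices; strictness comes from the bound on \<open>v x\<close>.\<close>
        have "4 = 1 / (2 * (C2 * R powr b)) * (C1 * (8 * C2 / C1 * R powr b))"
          using positive R0 by (simp add: field_simps)
        also have "\<dots> \<le> 1 / (2 * (C2 * R powr b)) * (C1 * (l powr b * R powr b))"
          using lb positive by (intro mult_left_mono mult_right_mono) auto
        also have "\<dots> = 1 / (2 * (C2 * R powr b)) * (C1 * (l * R) powr b)"
          using l R0 by (simp add: powr_mult)
        also have "\<dots> < (v x)\<^sup>2 * (C1 * (l * R) powr b)"
          using x positive l R0 by (intro mult_strict_right_mono) auto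
        finally show ?thesis .
      qed
      ultimately have "(v x)\<^sup>2 \<le> 4 * (l * R) * e" by (rule energy_lower)
      with x have "1 / (2 * (C2 * R powr b)) \<le> 4 * (l * R) * e" by simp
      then have "1 \<le> 8 * C2 * l * (R powr b * R) * e"
        using positive R0 by (simp add: field_simps)
      \<comment> \<open>Here \<open>\<gamma> = b + 1\<close> matters: the volume exponent and the
        one factor \<open>R\<close> from the resistance bound combine to
        \<open>R powr \<gamma>\<close>.\<close>
      also have "R powr b * R = 2 * K" using R0 R\<gamma> by (simp add: gamma powr_add)
      also have "8 * C2 * l * (2 * K) * e \<le> 8 * C2 * l * (2 * (A * (V + 1))) * e"
      proof -
        have "K \<le> A * (V + 1)" using real by (simp add: K_def A_def algebra_simps)
        then show ?thesis using positive l e0 by (intro mult_right_mono mult_left_mono) auto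
      qed
      finally have "C \<le> (V + 1) * e"
        using positive l A by (simp add: C_def field_simps)
      then have "ennreal C \<le> ennreal ((V + 1) * e)" by (rule ennreal_leI)
      also have "\<dots> = (spatial_variance \<mu> \<gamma> u + 1) * energy D E u"
        using real e0 by (simp add: energy ennreal_mult)
      finally show ?thesis .
    qed
  qed
  with C show ?thesis by blast
qed

end
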